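(* Let $\overline{\mathcal{T}}=\{(a,b)\in\mathbb{R}^2: 0\le a\le b\le 1\}$ and let $H:\overline{\mathcal{T}}\to\mathbb{R}$ be an analytic function given by a power series $$H(a,b)=\sum_{i,j\ge 0}c_{ij}a^ib^j$$ with real coefficients $c_{ij}$, converging absolutely at every point of $\overline{\mathcal{T}}$. Suppose that for each integer $p\ge 0$ there exists a constant $c_p$ such that for all integers $i,j\ge 0$ with $i+j=p$, $c_{ij}=c_p$. Then the functions $f:[0,1]\to\mathbb{R}$ for which $\mathrm{DQ}_f=H$ on $\overline{\mathcal{T}}$ are exactly the functions of the form $$f(x)=\left(\sum_{p=0}^{\infty}c_p x^{p+1}\right)+C,$$ where $C\in\mathbb{R}$ is a constant.
   Context: For a function $f:[0,1]\to\mathbb{R}$, the difference quotient is $\mathrm{DQ}_f(a,b)=\dfrac{f(b)-f(a)}{b-a}$ for $0\le a<b\le 1$. It is extended to the diagonal by $\mathrm{DQ}_f(a,a)=f'(a)$ for $0\le a\le 1$, provided that the derivative exists (one-sided at the endpoints $0$ and $1$). Thus $\mathrm{DQ}_f=H$ on $\overline{\mathcal{T}}$ means that $f$ is differentiable on $[0,1]$, $f'(a)=H(a,a)$ for every $a\in[0,1]$, and $\frac{f(b)-f(a)}{b-a}=H(a,b)$ for all $0\le a<b\le1$. All variables and functions are real-valued. *)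

theory Defs
  imports "HOL-Analysis.Analysis"
begin

definition closed_triangle :: "(real \<times> real) set" where
  "closed_triangle = {(a, b). 0 \<le> a \<and> a \<le> b \<and> b \<le> 1}"

text \<open>
  A function on the unit interval is represented by a total function, of which only the values on
  \<open>{0..1}\<close> matter: derivatives are taken within \<open>{0..1}\<close>, hence are one-sided at \<open>0\<close> and \<open>1\<close>.
  On the diagonal, \<open>DQ f\<close> is meaningful only where \<open>f\<close> is differentiable.
\<close>

definition DQ :: "(real \<Rightarrow> real) \<Rightarrow> real \<times> real \<Rightarrow> real" where
  "DQ f = (\<lambda>(a, b). if a = b then vector_derivative f (at a within {0..1})
                    else (f b - f a) / (b - a))"

text \<open>
  Equality of \<open>DQ f\<close> and \<open>H\<close> on the closed triangle includes the existence of \<open>DQ f\<close> on the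
  diagonal; \<open>vector_derivative\<close> alone has an arbitrary value at points of non-differentiability.
\<close>

definition DQ_eq_on_triangle :: "(real \<Rightarrow> real) \<Rightarrow> (real \<times> real \<Rightarrow> real) \<Rightarrow> bool" where
  "DQ_eq_on_triangle f H \<longleftrightarrow>
     f differentiable_on {0..1} \<and> (\<forall>z\<in>closed_triangle. DQ f z = H z)"

end

theory Submission
  imports Defs
begin

text \<open>
  Put \<open>F x = (\<Sum>p. c' p * x ^ (p + 1))\<close>. Summing the double series along the antidiagonals
  \<open>i + j = p\<close>, on which the coefficient is the constant \<open>c' p\<close>, gives
  \<open>H (a, b) = (\<Sum>p. c' p * (\<Sum>i\<le>p. a ^ i * b ^ (p - i)))\<close>. The inner sum is the quotient
  \<open>(b ^ (p + 1) - a ^ (p + 1)) / (b - a)\<close> off the diagonal and \<open>(p + 1) * a ^ p\<close> on it. So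
  \<open>(b - a) * H (a, b) = F b - F a\<close> (\<open>telescoped_series\<close>), and \<open>H (a, a)\<close> is the termwise
  derivative of \<open>F\<close> at \<open>a\<close>.

  If \<open>f\<close> has difference quotient \<open>H\<close>, the case \<open>a = 0\<close> already forces \<open>f x = F x + f 0\<close>.
  Conversely, such an \<open>f\<close> has the right difference quotients off the diagonal, and on the diagonal
  one has to differentiate \<open>F\<close> termwise, up to and including the endpoint \<open>1\<close>. This is possible
  because absolute convergence at the corner \<open>(1, 1)\<close>, where every point of an antidiagonal
  contributes the same amount, says that \<open>(\<Sum>p. (p + 1) * \<bar>c' p\<bar>)\<close> is finite; that makes the
  differentiated series converge uniformly on \<open>[0,1]\<close>.
\<close>

lemma has_sum_imp_antidiagonal_sums:
  fixes g :: "nat \<Rightarrow> nat \<Rightarrow> real"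
  assumes "((\<lambda>(i, j). g i j) has_sum S) UNIV"
  shows "(\<lambda>p. \<Sum>i\<le>p. g i (p - i)) sums S"
proof -
  have "bij_betw (\<lambda>(p, i). (i, p - i)) (SIGMA p:UNIV. {..p}) (UNIV :: (nat \<times> nat) set)"
    by (rule bij_betw_byWitness[where f' = "\<lambda>(i, j). (i + j, i)"]) auto
  from has_sum_reindex_bij_betw[OF this, of "\<lambda>(i, j). g i j" S] assms
  have "((\<lambda>(p, i). g i (p - i)) has_sum S) (SIGMA p:UNIV. {..p})"
    by (simp add: case_prod_unfold)
  then have "((\<lambda>p. \<Sum>i\<le>p. g i (p - i)) has_sum S) UNIV"
    by (rule has_sum_SigmaD) (simp add: has_sum_finite)
  then show ?thesis
    by (rule has_sum_imp_sums)
qed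

text \<open>
  The factor \<open>p + 1\<close> counts the lattice points on the antidiagonal \<open>i + j = p\<close>, over which the
  term \<open>\<bar>d p\<bar>\<close> is repeated.
\<close>

lemma summable_weighted_if_antidiagonally_constant:
  fixes d :: "nat \<Rightarrow> real"
  assumes "(\<lambda>(i, j). \<bar>d (i + j)\<bar>) summable_on UNIV"
  shows "summable (\<lambda>p. (real p + 1) * \<bar>d p\<bar>)"
proof -
  obtain S where "((\<lambda>(i, j). \<bar>d (i + j)\<bar>) has_sum S) UNIV"
    using assms by (auto simp: summable_on_def)
  from has_sum_imp_antidiagonal_sums[OF this] show ?thesis
    by (simp add: sums_iff algebra_simps)
qed

text \<open>
  Multiplying by \<open>b - a\<close> collapses each antidiagonal: the geometric sum over \<open>i + j = p\<close> telescopes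
  to \<open>b ^ (p + 1) - a ^ (p + 1)\<close>.
\<close>

lemma telescoped_series:
  fixes d :: "nat \<Rightarrow> real" and a b :: real
  assumes "((\<lambda>(i, j). d (i + j) * a ^ i * b ^ j) has_sum S) UNIV"
  shows "(\<lambda>p. d p * b ^ (p + 1) - d p * a ^ (p + 1)) sums ((b - a) * S)"
proof -
  have "(\<Sum>i\<le>p. (b - a) * (d p * a ^ i * b ^ (p - i))) = d p * b ^ (p + 1) - d p * a ^ (p + 1)"
    for p
  proof -
    have "(\<Sum>i\<le>p. (b - a) * (d p * a ^ i * b ^ (p - i)))
        = - (d p * ((a - b) * (\<Sum>i\<le>p. b ^ (p - i) * a ^ i)))"
      by (simp add: sum_distrib_left sum_negf[symmetric] algebra_simps)
    also have "(a - b) * (\<Sum>i\<le>p. b ^ (p - i) * a ^ i) = a ^ (p + 1) - b ^ (p + 1)"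
      using power_diff_sumr2[of a "p + 1" b] by (simp add: lessThan_Suc_atMost)
    finally show ?thesis
      by (simp add: algebra_simps)
  qed
  with sums_mult[OF has_sum_imp_antidiagonal_sums[OF assms], of "b - a"] show ?thesis
    by (simp add: sum_distrib_left)
qed

lemma diagonal_series:
  fixes d :: "nat \<Rightarrow> real" and a :: real
  assumes "((\<lambda>(i, j). d (i + j) * a ^ i * a ^ j) has_sum S) UNIV"
  shows "(\<lambda>p. d p * ((real p + 1) * a ^ p)) sums S"
proof -
  have "(\<Sum>i\<le>p. d (i + (p - i)) * a ^ i * a ^ (p - i)) = d p * ((real p + 1) * a ^ p)" for p
  proof -
    have "(\<Sum>i\<le>p. d (i + (p - i)) * a ^ i * a ^ (p - i)) = (\<Sum>i\<le>p. d p * a ^ p)"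
      by (rule sum.cong) (simp_all add: mult.assoc flip: power_add)
    then show ?thesis
      by (simp add: algebra_simps)
  qed
  with has_sum_imp_antidiagonal_sums[OF assms] show ?thesis
    by simp
qed

lemma abs_mult_le_if_bounded_by_1:
  fixes t u :: real
  assumes "\<bar>t\<bar> \<le> 1"
  shows "\<bar>u * t\<bar> \<le> \<bar>u\<bar>"
  using mult_left_mono[OF assms, of "\<bar>u\<bar>"] by (simp add: abs_mult)

text \<open>
  Termwise differentiation of a power series is automatic only inside the disc of convergence,
  and the point \<open>1\<close> may lie on its boundary. The weighted summability of the coefficients
  dominates the derivatives uniformly on the closed interval, which covers both endpoints.
\<close>

lemma has_field_derivative_power_series_unit_interval:
  fixes d :: "nat \<Rightarrow> real"
  assumes weighted: "summable (\<lambda>p. (real p + 1) * \<bar>d p\<bar>)" and x: "x \<in> {0..1}"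
  shows "((\<lambda>x. \<Sum>p. d p * x ^ (p + 1)) has_field_derivative (\<Sum>p. d p * ((real p + 1) * x ^ p)))
           (at x within {0..1})"
proof -
  have "uniform_limit {0..1} (\<lambda>n x. \<Sum>p<n. d p * ((real p + 1) * x ^ p))
          (\<lambda>x. \<Sum>p. d p * ((real p + 1) * x ^ p)) sequentially"
  proof (rule Weierstrass_m_test[OF _ weighted])
    fix p and y :: real assume "y \<in> {0..1}"
    then have "\<bar>y ^ p\<bar> \<le> 1"
      by (simp add: power_le_one)
    from abs_mult_le_if_bounded_by_1[OF this, of "d p * (real p + 1)"]
    show "norm (d p * ((real p + 1) * y ^ p)) \<le> (real p + 1) * \<bar>d p\<bar>"
      by (simp add: abs_mult mult_ac)
  qed
  moreover have "((\<lambda>x. d p * x ^ (p + 1)) has_field_derivative d p * ((real p + 1) * y ^ p))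
                   (at y within {0..1})" for p y
  proof (rule DERIV_cmult)
    show "((\<lambda>x. x ^ (p + 1)) has_field_derivative (real p + 1) * y ^ p) (at y within {0..1})"
      using DERIV_power_Suc[OF DERIV_ident, of p y "{0..1}"] by (simp add: add.commute)
  qed
  moreover have "summable (\<lambda>p. d p * 0 ^ (p + 1))"
    by simp
  ultimately have "\<exists>g. \<forall>y\<in>{0..1}. (\<lambda>p. d p * y ^ (p + 1)) sums g y \<and>
      (g has_field_derivative (\<Sum>p. d p * ((real p + 1) * y ^ p))) (at y within {0..1})"
    by (intro has_field_derivative_series[where ?x0.0 = 0]) simp_all
  then obtain g where
    g: "\<And>y. y \<in> {0..1} \<Longrightarrow> (\<lambda>p. d p * y ^ (p + 1)) sums g y \<and>
          (g has_field_derivative (\<Sum>p. d p * ((real p + 1) * y ^ p))) (at y within {0..1})"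
    by blast
  show ?thesis
  proof (rule has_field_derivative_transform_within[OF _ zero_less_one x])
    show "(g has_field_derivative (\<Sum>p. d p * ((real p + 1) * x ^ p))) (at x within {0..1})"
      using g x by blast
    show "g y = (\<Sum>p. d p * y ^ (p + 1))" if "y \<in> {0..1}" for y
      using g[OF that] by (intro sums_unique) blast
  qed
qed

theorem corollary8:
  fixes H :: "real \<times> real \<Rightarrow> real"
    and c :: "nat \<Rightarrow> nat \<Rightarrow> real"
    and c' :: "nat \<Rightarrow> real"
    and f :: "real \<Rightarrow> real"
  assumes abs_conv: "\<And>a b. (a, b) \<in> closed_triangle \<Longrightarrow>
      (\<lambda>(i, j). \<bar>c i j * a ^ i * b ^ j\<bar>) summable_on UNIV"
    and series: "\<And>a b. (a, b) \<in> closed_triangle \<Longrightarrow>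
      ((\<lambda>(i, j). c i j * a ^ i * b ^ j) has_sum H (a, b)) UNIV"
    and const: "\<And>p i j. i + j = p \<Longrightarrow> c i j = c' p"
  shows "DQ_eq_on_triangle f H \<longleftrightarrow>
    (\<exists>C. \<forall>x\<in>{0..1}. summable (\<lambda>p. c' p * x ^ (p + 1)) \<and>
                    f x = (\<Sum>p. c' p * x ^ (p + 1)) + C)"
proof -
  define F where "F x = (\<Sum>p. c' p * x ^ (p + 1))" for x
  have c: "c i j = c' (i + j)" for i j
    using const by simp
  have H: "((\<lambda>(i, j). c' (i + j) * a ^ i * b ^ j) has_sum H (a, b)) UNIV"
    if "0 \<le> a" "a \<le> b" "b \<le> 1" for a b
    using series[of a b] that by (simp add: c closed_triangle_def)
  have weighted: "summable (\<lambda>p. (real p + 1) * \<bar>c' p\<bar>)"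
    using abs_conv[of 1 1]
    by (intro summable_weighted_if_antidiagonally_constant) (simp add: c closed_triangle_def)
  have summable: "summable (\<lambda>p. c' p * x ^ (p + 1))" if "x \<in> {0..1}" for x
    (* the point (0, x) of the triangle; the subtracted terms vanish there *)
    using telescoped_series[OF H[of 0 x]] that by (auto simp: sums_iff)
  have F_diff: "F b - F a = (b - a) * H (a, b)" if "0 \<le> a" "a \<le> b" "b \<le> 1" for a b
    using telescoped_series[OF H[OF that]] suminf_diff[OF summable[of b] summable[of a]] that
    by (simp add: F_def sums_iff)
  have F_deriv: "(F has_field_derivative H (a, a)) (at a within {0..1})" if "a \<in> {0..1}" for a
    using has_field_derivative_power_series_unit_interval[OF weighted that]
      diagonal_series[OF H[of a a]] that
    unfolding F_def by (simp add: sums_iff)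

  show ?thesis
  proof
    assume dq: "DQ_eq_on_triangle f H"
    have "f x = F x + f 0" if x: "x \<in> {0..1}" for x
    proof (cases "x = 0")
      case False
      with x dq have "(f x - f 0) / (x - 0) = H (0, x)"
        by (force simp: DQ_eq_on_triangle_def DQ_def closed_triangle_def)
      with F_diff[of 0 x] x False show ?thesis
        by (simp add: F_def field_simps)
    qed (simp add: F_def)
    with summable show "\<exists>C. \<forall>x\<in>{0..1}. summable (\<lambda>p. c' p * x ^ (p + 1)) \<and>
                    f x = (\<Sum>p. c' p * x ^ (p + 1)) + C"
      unfolding F_def by blast
  next
    assume "\<exists>C. \<forall>x\<in>{0..1}. summable (\<lambda>p. c' p * x ^ (p + 1)) \<and>
                    f x = (\<Sum>p. c' p * x ^ (p + 1)) + C"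
    then obtain C where f: "\<And>x. x \<in> {0..1} \<Longrightarrow> f x = F x + C"
      unfolding F_def by blast
    have f_deriv: "(f has_field_derivative H (a, a)) (at a within {0..1})" if "a \<in> {0..1}" for a
    proof (rule has_field_derivative_transform_within[OF _ zero_less_one that])
      show "((\<lambda>x. F x + C) has_field_derivative H (a, a)) (at a within {0..1})"
        using F_deriv[OF that] by (auto intro!: derivative_eq_intros)
    qed (simp add: f)
    have "DQ f (a, b) = H (a, b)" if ab: "0 \<le> a" "a \<le> b" "b \<le> 1" for a b
    proof (cases "a = b")
      case True
      have "vector_derivative f (at a within {0..1}) = H (a, a)"
        using f_deriv[of a] ab
        by (intro vector_derivative_within_closed_interval)
           (auto simp: has_real_derivative_iff_has_vector_derivative)
      with True show ?thesis
        by (simp add: DQ_def)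
    next
      case False
      with F_diff[OF ab] ab show ?thesis
        by (simp add: DQ_def f)
    qed
    moreover have "f differentiable_on {0..1}"
      unfolding differentiable_on_def real_differentiable_def using f_deriv by blast
    ultimately show "DQ_eq_on_triangle f H"
      by (auto simp: DQ_eq_on_triangle_def closed_triangle_def)
  qed
qed

end
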